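(* Let $k\geq 3$. There is no $k$-geodetic digraph with minimum out-degree at least $2$ and order $M(2,k)+2$ (where $M(2,k)=1+2+\dots+2^k$) whose in-degree sequence is $(1,1,1,2,\dots,2,3,3,3)$, i.e. exactly three vertices have in-degree $1$, exactly three have in-degree $3$, and all others have in-degree $2$.
   Context: A digraph is $k$-geodetic if for any two vertices $u,v$ there is at most one directed walk from $u$ to $v$ of length at most $k$. The in-degree sequence is the list of in-degrees in non-decreasing order. *)

theory Defs
  imports "HOL-Library.Multiset" "Graph_Theory.Graph_Theory"
begin

text \<open>Walks are lists of arcs; the empty walk from a vertex to itself has length 0 and is
  counted. Hence a \<open>k\<close>-geodetic digraph has no closed walk of length between 1 and \<open>k\<close>.\<close>

definition k_geodetic :: "nat \<Rightarrow> ('a, 'b) pre_digraph \<Rightarrow> bool" where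
  "k_geodetic k G \<longleftrightarrow>
     (\<forall>u\<in>verts G. \<forall>v\<in>verts G. \<exists>\<^sub>\<le>\<^sub>1 p. pre_digraph.awalk G u p v \<and> length p \<le> k)"

definition moore_bound :: "nat \<Rightarrow> nat \<Rightarrow> nat" where
  "moore_bound d k = (\<Sum>i=0..k. d ^ i)"

text \<open>Only meaningful when \<open>verts G\<close> is finite and nonempty.\<close>

definition min_out_degree :: "('a, 'b) pre_digraph \<Rightarrow> nat" where
  "min_out_degree G = Min (out_degree G ` verts G)"

text \<open>The argument is a multiset, so each vertex contributes one entry even when in-degrees
  coincide. Only meaningful when \<open>verts G\<close> is finite.\<close>

definition in_degree_sequence :: "('a, 'b) pre_digraph \<Rightarrow> nat list" where
  "in_degree_sequence G = sorted_list_of_multiset (image_mset (in_degree G) (mset_set (verts G)))"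

lemma count_in_degrees:
  assumes "finite (verts G)"
  shows "count (image_mset (in_degree G) (mset_set (verts G))) d
         = card {v \<in> verts G. in_degree G v = d}"
proof -
  have "in_degree G -` {d} \<inter> verts G = {v \<in> verts G. in_degree G v = d}" by auto
  then show ?thesis using assms by (simp add: count_image_mset)
qed

lemma in_degree_sequence_iff:
  assumes fin: "finite (verts G)"
  shows "in_degree_sequence G = replicate 3 1 @ replicate (card (verts G) - 6) 2 @ replicate 3 3 \<longleftrightarrow>
         card {v \<in> verts G. in_degree G v = 1} = 3 \<and>
         card {v \<in> verts G. in_degree G v = 3} = 3 \<and>
         (\<forall>v\<in>verts G. in_degree G v \<in> {1, 2, 3})"
    (is "_ = ?xs \<longleftrightarrow> ?R")
proof -
  let ?M = "image_mset (in_degree G) (mset_set (verts G))"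
  let ?C = "\<lambda>d. {v \<in> verts G. in_degree G v = d}"
  have eq: "in_degree_sequence G = ?xs \<longleftrightarrow> ?M = mset ?xs"
  proof
    assume "in_degree_sequence G = ?xs"
    then show "?M = mset ?xs" unfolding in_degree_sequence_def
      by (metis mset_sorted_list_of_multiset)
  next
    assume "?M = mset ?xs"
    then have "in_degree_sequence G = sort ?xs"
      unfolding in_degree_sequence_def by (metis sorted_list_of_multiset_mset)
    moreover have "sort ?xs = ?xs"
      by (rule sorted_sort_id) (auto simp: sorted_append)
    ultimately show "in_degree_sequence G = ?xs" by simp
  qed
  have "?M = mset ?xs \<longleftrightarrow> (\<forall>d. card (?C d) = count (mset ?xs) d)"
    by (simp only: multiset_eq_iff count_in_degrees[OF fin])
  also have "\<dots> \<longleftrightarrow> ?R"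
  proof
    assume a: "\<forall>d. card (?C d) = count (mset ?xs) d"
    have "in_degree G v \<in> {1,2,3}" if "v \<in> verts G" for v
    proof (rule ccontr)
      assume "in_degree G v \<notin> {1,2,3}"
      then have "card (?C (in_degree G v)) = 0" using a by auto
      then show False using fin that by auto
    qed
    moreover have "card (?C 1) = 3" "card (?C 3) = 3"
      using a[rule_format, of 1] a[rule_format, of 3] by auto
    ultimately show ?R by blast
  next
    assume r: ?R
    have "verts G = ?C 1 \<union> ?C 2 \<union> ?C 3" using r by auto
    then have "card (verts G) = card (?C 1 \<union> ?C 2 \<union> ?C 3)" by simp
    also have "\<dots> = card (?C 1) + card (?C 2) + card (?C 3)"
      using fin by (subst card_Un_disjoint; (subst card_Un_disjoint)?; auto)
    finally have c2: "card (?C 2) = card (verts G) - 6" using r by linarith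
    show "\<forall>d. card (?C d) = count (mset ?xs) d"
    proof
      fix d :: nat
      consider "d = 1" | "d = 2" | "d = 3" | "d \<notin> {1,2,3}" by blast
      then show "card (?C d) = count (mset ?xs) d"
      proof cases
        case 4
        then have "?C d = {}" using r by auto
        then have "card (?C d) = 0" by (simp only: card.empty)
        then show ?thesis using 4 by auto
      qed (use r c2 in auto)
    qed
  qed
  finally show ?thesis using eq by blast
qed

end

theory Submission
  imports Defs
begin

text \<open>
  Every vertex \<open>u\<close> misses exactly two vertices within distance \<open>k\<close>, its outliers \<open>O u\<close>.
  Let \<open>S\<close> and \<open>X\<close> be the sets of vertices of in-degree 1 and 3, and let \<open>A\<close> be the adjacency matrix. Since \<open>A\<close> commutes with
  \<open>I + A + \<dots> + A^k\<close>, for each \<open>u\<close> there is a vertex \<open>r\<close> such that, as multisets, the outlier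
  sets of the two out-neighbours of \<open>u\<close> add up to \<open>S + r\<close>, and the out-neighbourhoods of the two
  outliers of \<open>u\<close> add up to \<open>X + r\<close>. Hence some outlier set is contained in \<open>S\<close>, and some
  \<open>a1 \<in> S\<close> has both out-neighbours in \<open>X\<close>.

  An in-tree of depth \<open>k\<close> rooted in \<open>x \<in> X\<close> fits into the digraph only if vertices of \<open>S\<close> lie close
  to \<open>x\<close>: either two of them are in-neighbours of \<open>x\<close>, or one is and the other two
  are at distance exactly 2, and then no vertex of \<open>X\<close> is an in-neighbour of \<open>x\<close>. This leaves two shapes. In the
  first all arcs leaving \<open>S\<close> end in \<open>X\<close>, and an outlier set contained in \<open>S\<close> yields a transitive triangle. In the
  second \<open>a1 \<rightarrow> x1, x2\<close>, while \<open>a2\<close> and \<open>a3\<close> have \<open>x3\<close> and a vertex \<open>z2\<close> resp. \<open>z3\<close> with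
  out-neighbours \<open>x1, x2\<close> as out-neighbours. Then each vertex at distance less than \<open>k\<close> from \<open>x3\<close> is at distance
  exactly \<open>k - 1\<close> from precisely one of \<open>x1\<close> and \<open>x2\<close>, and the choice alternates along arcs. So
  levels \<open>k - 1\<close> and \<open>k - 3\<close> below \<open>x3\<close> both lie in level \<open>k - 1\<close> below the same \<open>xi\<close>, which
  is too small to hold them.
\<close>

section \<open>Walk counts and outliers in 2-out-regular digraphs of excess two\<close>

primrec walks :: "('a \<Rightarrow> 'a set) \<Rightarrow> nat \<Rightarrow> 'a \<Rightarrow> 'a \<Rightarrow> nat" where
  "walks N 0 u v = of_bool (u = v)"
| "walks N (Suc j) u v = (\<Sum>w\<in>N u. walks N j w v)"

text \<open>With \<open>A\<close> the adjacency matrix, \<open>walks N j\<close> is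
  \<open>A^j\<close> and this is \<open>I + A + ... + A^m\<close>.\<close>

definition walks_upto :: "('a \<Rightarrow> 'a set) \<Rightarrow> nat \<Rightarrow> 'a \<Rightarrow> 'a \<Rightarrow> nat" where
  "walks_upto N m u v = (\<Sum>j\<le>m. walks N j u v)"

text \<open>The order is the Moore bound \<open>2 ^ Suc k - 1\<close> plus 2. A digraph without
  parallel arcs is encoded by its out-neighbourhoods.\<close>

locale excess_two =
  fixes V :: "'a set" and N :: "'a \<Rightarrow> 'a set" and k :: nat
  assumes finite_V: "finite V"
    and N_sub: "u \<in> V \<Longrightarrow> N u \<subseteq> V"
    and card_N: "u \<in> V \<Longrightarrow> card (N u) = 2"
    and k_ge_3: "3 \<le> k"
    and card_V: "card V = 2 ^ Suc k + 1"
    and geodetic: "u \<in> V \<Longrightarrow> v \<in> V \<Longrightarrow> walks_upto N k u v \<le> 1"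
begin

abbreviation W :: "nat \<Rightarrow> 'a \<Rightarrow> 'a \<Rightarrow> nat" where "W \<equiv> walks N"
abbreviation B :: "nat \<Rightarrow> 'a \<Rightarrow> 'a \<Rightarrow> nat" where "B \<equiv> walks_upto N"

definition preds :: "'a \<Rightarrow> 'a set" where "preds v = {u \<in> V. v \<in> N u}"
definition outliers :: "'a \<Rightarrow> 'a set" where "outliers u = {v \<in> V. B k u v = 0}"

lemma finite_N: "u \<in> V \<Longrightarrow> finite (N u)"
  using N_sub finite_V finite_subset by blast

lemma finite_preds: "finite (preds v)"
  by (simp add: preds_def finite_V)

lemma finite_outliers: "finite (outliers u)"
  by (simp add: outliers_def finite_V)

lemma in_N_V: "u \<in> V \<Longrightarrow> v \<in> N u \<Longrightarrow> v \<in> V"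
  using N_sub by blast

lemma N_two:
  assumes "u \<in> V"
  obtains w w' where "N u = {w, w'}" "w \<noteq> w'" "w \<in> V" "w' \<in> V"
  using card_N[OF assms] N_sub[OF assms] by (auto simp: card_2_iff)

lemma walks_upto_Suc: "B (Suc m) u v = of_bool (u = v) + (\<Sum>w\<in>N u. B m w v)"
  unfolding walks_upto_def by (subst sum.atMost_Suc_shift) (simp add: sum.swap[of _ "N u"])

lemma walks_upto_mono: "m \<le> m' \<Longrightarrow> B m u v \<le> B m' u v"
  unfolding walks_upto_def by (rule sum_mono2) auto

lemma walks_le_upto: "j \<le> m \<Longrightarrow> W j u v \<le> B m u v"
  unfolding walks_upto_def by (rule member_le_sum) auto

text \<open>Entrywise form of \<open>A * A^j = A^j * A\<close>: both sides count walks of length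
  \<open>Suc j\<close>, split at the first or at the last arc.\<close>

lemma sum_N_preds:
  assumes "u \<in> V" "v \<in> V"
  shows "(\<Sum>w\<in>N u. W j w v) = (\<Sum>w\<in>preds v. W j u w)"
  using assms
proof (induction j arbitrary: u)
  case 0
  have "(\<Sum>w\<in>N u. W 0 w v) = of_bool (v \<in> N u)"
    using finite_N[OF 0(1)] by (simp add: of_bool_def sum.delta)
  also have "\<dots> = (\<Sum>w\<in>preds v. W 0 u w)"
    using 0 finite_preds[of v] by (simp add: of_bool_def preds_def sum.delta)
  finally show ?case .
next
  case (Suc j)
  have "(\<Sum>w\<in>N u. W (Suc j) w v) = (\<Sum>w\<in>N u. \<Sum>x\<in>preds v. W j w x)"
    using Suc by (intro sum.cong) (auto simp: in_N_V)
  also have "\<dots> = (\<Sum>x\<in>preds v. \<Sum>w\<in>N u. W j w x)" by (rule sum.swap)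
  finally show ?case by simp
qed

lemma sum_upto_N_preds:
  assumes "u \<in> V" "v \<in> V"
  shows "(\<Sum>w\<in>N u. B m w v) = (\<Sum>w\<in>preds v. B m u w)"
  unfolding walks_upto_def
  by (simp add: sum.swap[of _ "{..m}"] sum_N_preds[OF assms])

lemma sum_walks: "u \<in> V \<Longrightarrow> (\<Sum>v\<in>V. W j u v) = 2 ^ j"
proof (induction j arbitrary: u)
  case 0
  then show ?case using finite_V by (simp add: of_bool_def sum.delta)
next
  case (Suc j)
  have "(\<Sum>v\<in>V. W (Suc j) u v) = (\<Sum>w\<in>N u. \<Sum>v\<in>V. W j w v)"
    by (simp add: sum.swap[of _ V])
  also have "\<dots> = (\<Sum>w\<in>N u. 2 ^ j)"
    using Suc by (intro sum.cong) (auto simp: in_N_V)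
  finally show ?case using card_N[OF Suc.prems] by simp
qed

lemma sum_walks_upto: "u \<in> V \<Longrightarrow> (\<Sum>v\<in>V. B m u v) = 2 ^ Suc m - 1"
proof -
  assume u: "u \<in> V"
  have "(\<Sum>v\<in>V. B m u v) = (\<Sum>j\<le>m. 2 ^ j)"
    unfolding walks_upto_def by (subst sum.swap) (simp add: sum_walks[OF u])
  also have "\<dots> = 2 ^ Suc m - 1"
    by (induction m) auto
  finally show ?thesis .
qed

lemma upto_eq:
  assumes "u \<in> V" "v \<in> V"
  shows "B k u v + of_bool (v \<in> outliers u) = 1"
  using geodetic[OF assms] assms by (auto simp: outliers_def le_Suc_eq)

lemma card_outliers:
  assumes "u \<in> V" shows "card (outliers u) = 2"
proof -
  have "(\<Sum>v\<in>V. B k u v + of_bool (v \<in> outliers u)) = card V"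
    using upto_eq[OF assms] by simp
  moreover have "(\<Sum>v\<in>V. of_bool (v \<in> outliers u)) = card (outliers u)"
    using finite_V by (simp add: outliers_def Int_def)
  moreover have "(2::nat) ^ Suc k \<ge> 1" by simp
  ultimately show ?thesis
    using card_V sum_walks_upto[OF assms, of k] by (simp add: sum.distrib)
qed

text \<open>Let \<open>O\<close> be the outlier matrix and \<open>J\<close> the all-ones matrix, so
  that \<open>I + A + ... + A^k = J - O\<close>. This commutes with \<open>A\<close>; the entries of
  \<open>AJ\<close> are 2 and those of \<open>JA\<close> are in-degrees. Terms are moved across to
  avoid subtraction of naturals.\<close>

lemma outlier_identity:
  assumes "u \<in> V" "v \<in> V"
  shows "(\<Sum>w\<in>N u. of_bool (v \<in> outliers w)) + card (preds v)
       = 2 + (\<Sum>w\<in>outliers u. of_bool (v \<in> N w) :: nat)"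
proof -
  have "(\<Sum>w\<in>N u. B k w v + of_bool (v \<in> outliers w)) = (\<Sum>w\<in>N u. 1)"
    using assms by (intro sum.cong upto_eq refl) (auto simp: in_N_V)
  then have 1: "(\<Sum>w\<in>N u. B k w v) + (\<Sum>w\<in>N u. of_bool (v \<in> outliers w)) = 2"
    using card_N[OF assms(1)] by (simp add: sum.distrib)
  have "(\<Sum>w\<in>preds v. B k u w + of_bool (w \<in> outliers u)) = (\<Sum>w\<in>preds v. 1)"
    using assms by (intro sum.cong upto_eq refl) (auto simp: preds_def)
  then have 2: "(\<Sum>w\<in>preds v. B k u w) + (\<Sum>w\<in>preds v. of_bool (w \<in> outliers u)) = card (preds v)"
    by (simp add: sum.distrib)
  have "(\<Sum>w\<in>preds v. of_bool (w \<in> outliers u)) = card (preds v \<inter> outliers u)"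
    using finite_preds by (simp add: Int_def)
  also have "preds v \<inter> outliers u = outliers u \<inter> {w. v \<in> N w}"
    by (auto simp: preds_def outliers_def)
  also have "card \<dots> = (\<Sum>w\<in>outliers u. of_bool (v \<in> N w))"
    using finite_outliers by (simp add: Int_def)
  finally show ?thesis using 1 2 sum_upto_N_preds[OF assms, of k] by simp
qed

lemma sum_preds:
  "(\<Sum>u\<in>V. \<Sum>w\<in>N u. g w) = (\<Sum>w\<in>V. card (preds w) * g w)" for g :: "'a \<Rightarrow> nat"
proof -
  have "(\<Sum>u\<in>V. \<Sum>w\<in>N u. g w) = (\<Sum>u\<in>V. \<Sum>w\<in>{w \<in> V. w \<in> N u}. g w)"
    using N_sub by (intro sum.cong) auto
  also have "\<dots> = (\<Sum>w\<in>V. \<Sum>u\<in>{u \<in> V. w \<in> N u}. g w)"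
    by (rule sum.swap_restrict) (rule finite_V)+
  finally show ?thesis by (simp add: preds_def)
qed

lemma loop_free: "u \<in> V \<Longrightarrow> j \<le> k \<Longrightarrow> 0 < j \<Longrightarrow> W j u u = 0"
proof -
  assume a: "u \<in> V" "j \<le> k" "0 < j"
  have "sum (\<lambda>j. W j u u) {0, j} \<le> B k u u"
    unfolding walks_upto_def using a by (intro sum_mono2) auto
  with a geodetic[of u u] show ?thesis by simp
qed

end

section \<open>Vertices of in-degree 1 and 3, and the replacement vertex\<close>

locale excess_two_near_regular = excess_two +
  fixes S X :: "'a set"
  assumes S_V: "S \<subseteq> V" and X_V: "X \<subseteq> V"
    and card_S: "card S = 3" and card_X: "card X = 3"
    and disj: "S \<inter> X = {}"
    and indegree: "v \<in> V \<Longrightarrow> card (preds v) + of_bool (v \<in> S) = 2 + of_bool (v \<in> X)"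
begin

lemma finite_S: "finite S" and finite_X: "finite X"
  using S_V X_V finite_V finite_subset by auto

text \<open>Inserting the in-degrees into \<open>outlier_identity\<close> leaves only the indicators
  of \<open>S\<close> and \<open>X\<close>. These sets are disjoint, so the first multiset contains
  \<open>S\<close>; it has size 4, which leaves one further element \<open>r\<close>. The identity
  then determines the second multiset.\<close>

lemma replacement:
  assumes "u \<in> V"
  obtains r where "(\<Sum>w\<in>N u. mset_set (outliers w)) = mset_set S + {#r#}"
    and "(\<Sum>w\<in>outliers u. mset_set (N w)) = mset_set X + {#r#}"
proof -
  let ?M = "\<Sum>w\<in>N u. mset_set (outliers w)" and ?M' = "\<Sum>w\<in>outliers u. mset_set (N w)"
  have outV: "outliers w \<subseteq> V" for w by (auto simp: outliers_def)
  have c: "count ?M v = (\<Sum>w\<in>N u. of_bool (v \<in> outliers w))" for v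
    by (auto simp: count_sum count_mset_set' finite_outliers intro!: sum.cong)
  have c': "count ?M' v = (\<Sum>w\<in>outliers u. of_bool (v \<in> N w))" for v
    unfolding count_sum
    by (rule sum.cong) (use outV finite_N in \<open>auto simp: count_mset_set'\<close>)
  have id: "count ?M v + of_bool (v \<in> X) = count ?M' v + of_bool (v \<in> S)" for v
  proof (cases "v \<in> V")
    case True
    then show ?thesis using outlier_identity[OF assms True] indegree[OF True] c[of v] c'[of v] by simp
  next
    case False
    then have "v \<notin> outliers w" "w \<in> V \<Longrightarrow> v \<notin> N w" for w
      using outV in_N_V by auto
    then have "(\<Sum>w\<in>N u. of_bool (v \<in> outliers w)) = (0 :: nat)"
      and "(\<Sum>w\<in>outliers u. of_bool (v \<in> N w)) = (0 :: nat)"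
      using subsetD[OF outV] by (auto intro!: sum.neutral simp del: sum_of_bool_eq)
    with False show ?thesis using S_V X_V unfolding c c' by auto
  qed
  have sub: "mset_set S \<subseteq># ?M"
  proof (rule mset_subset_eqI)
    fix v
    have "v \<in> S \<Longrightarrow> count ?M v = Suc (count ?M' v)" using id[of v] disj by (auto simp: disjoint_iff)
    then show "count (mset_set S) v \<le> count ?M v"
      using finite_S by (cases "v \<in> S") simp_all
  qed
  have "size ?M = (\<Sum>w\<in>N u. 2)"
    unfolding size_multiset_sum using assms in_N_V
    by (intro sum.cong) (auto simp: card_outliers)
  then have "size (?M - mset_set S) = 1"
    using card_N[OF assms] card_S sub by (simp add: size_Diff_submset)
  then obtain r where r: "?M - mset_set S = {#r#}"
    using size_1_singleton_mset by blast
  have M: "?M = mset_set S + {#r#}"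
    using sub r by (metis subset_mset.add_diff_inverse)
  have "?M' = mset_set X + {#r#}"
  proof (rule multiset_eqI)
    fix v
    show "count ?M' v = count (mset_set X + {#r#}) v"
      using id[of v] finite_S finite_X unfolding M by (auto simp: count_mset_set' split: if_splits)
  qed
  with M that show thesis by blast
qed

section \<open>Counting in-trees by weights\<close>

text \<open>A vertex \<open>w\<close> of in-degree \<open>2 \<plusminus> 1\<close> with a walk of length \<open>j\<close> to \<open>v\<close> changes the number of
  vertices that reach \<open>v\<close> within \<open>m\<close> steps by \<open>\<plusminus> (2 ^ (m - j) - 1)\<close>.\<close>

definition wt :: "nat \<Rightarrow> 'a \<Rightarrow> 'a \<Rightarrow> int" where
  "wt m w v = (\<Sum>j\<le>m. (2 ^ (m - j) - 1) * int (W j w v))"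

lemma wt_Suc: "wt (Suc m) w v = 2 * wt m w v + int (B m w v)"
proof -
  have "wt (Suc m) w v = (\<Sum>j\<le>m. (2 ^ (Suc m - j) - 1) * int (W j w v))"
    by (simp add: wt_def)
  also have "\<dots> = (\<Sum>j\<le>m. 2 * ((2 ^ (m - j) - 1) * int (W j w v)) + int (W j w v))"
    by (rule sum.cong) (auto simp: Suc_diff_le algebra_simps)
  finally show ?thesis
    by (simp add: wt_def walks_upto_def sum.distrib sum_distrib_left)
qed

text \<open>Split a walk of length \<open>Suc j\<close> after its first arc: a walk from
  \<open>w\<close> is extended once per in-neighbour of \<open>w\<close>, hence twice up to
  corrections on \<open>S\<close> and \<open>X\<close>.\<close>

lemma column_sum_walks:
  assumes "v \<in> V"
  shows "(\<Sum>u\<in>V. W (Suc j) u v) + (\<Sum>a\<in>S. W j a v)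
       = 2 * (\<Sum>u\<in>V. W j u v) + (\<Sum>x\<in>X. W j x v)"
proof -
  have res: "(\<Sum>w\<in>V. of_bool (w \<in> Y) * W j w v) = (\<Sum>w\<in>Y. W j w v)" if "Y \<subseteq> V" for Y
  proof -
    have "(\<Sum>w\<in>Y. W j w v) = (\<Sum>w\<in>V \<inter> Y. W j w v)" using that by (simp add: Int_absorb1)
    also have "\<dots> = (\<Sum>w\<in>V. if w \<in> Y then W j w v else 0)"
      by (rule sum.inter_restrict[OF finite_V])
    also have "\<dots> = (\<Sum>w\<in>V. of_bool (w \<in> Y) * W j w v)"
      by (rule sum.cong) auto
    finally show ?thesis by simp
  qed
  have "(\<Sum>u\<in>V. W (Suc j) u v) + (\<Sum>a\<in>S. W j a v)
      = (\<Sum>w\<in>V. (card (preds w) + of_bool (w \<in> S)) * W j w v)"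
    by (simp add: sum_preds res[OF S_V, symmetric] sum.distrib[symmetric] distrib_right)
  also have "\<dots> = (\<Sum>w\<in>V. (2 + of_bool (w \<in> X)) * W j w v)"
    by (rule sum.cong) (simp_all add: indegree)
  also have "\<dots> = 2 * (\<Sum>u\<in>V. W j u v) + (\<Sum>x\<in>X. W j x v)"
    by (simp add: res[OF X_V, symmetric] sum_distrib_left sum.distrib[symmetric] distrib_right mult_2 add.assoc)
  finally show ?thesis .
qed

text \<open>If all in-degrees were 2, the sum would be \<open>2 ^ Suc m - 1\<close>. By
  \<open>column_sum_walks\<close> the deviation obeys the same doubling recursion as
  \<open>wt_Suc\<close>.\<close>

lemma column_sum_upto:
  assumes "v \<in> V"
  shows "int (\<Sum>u\<in>V. B m u v) = 2 ^ Suc m - 1 + (\<Sum>x\<in>X. wt m x v) - (\<Sum>a\<in>S. wt m a v)"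
proof (induction m)
  case 0
  show ?case using assms finite_V by (simp add: walks_upto_def wt_def of_bool_def sum.delta)
next
  case (Suc m)
  have one: "(\<Sum>u\<in>V. W 0 u v) = 1"
    using assms finite_V by (simp add: of_bool_def sum.delta)
  have split: "(\<Sum>u\<in>V. B (Suc m) u v) = 1 + (\<Sum>j\<le>m. \<Sum>u\<in>V. W (Suc j) u v)"
    unfolding walks_upto_def
    by (subst sum.swap, subst sum.atMost_Suc_shift) (simp add: one del: walks.simps)
  have "(\<Sum>j\<le>m. (\<Sum>u\<in>V. W (Suc j) u v) + (\<Sum>a\<in>S. W j a v))
      = (\<Sum>j\<le>m. 2 * (\<Sum>u\<in>V. W j u v) + (\<Sum>x\<in>X. W j x v))"
    by (simp only: column_sum_walks[OF assms])
  then have "(\<Sum>j\<le>m. \<Sum>u\<in>V. W (Suc j) u v) + (\<Sum>a\<in>S. B m a v)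
      = 2 * (\<Sum>u\<in>V. B m u v) + (\<Sum>x\<in>X. B m x v)"
    unfolding walks_upto_def
    by (simp add: sum.distrib sum.swap[of _ _ "{..m}"] sum_distrib_left del: walks.simps)
  then have "(\<Sum>u\<in>V. B (Suc m) u v) + (\<Sum>a\<in>S. B m a v)
      = 1 + 2 * (\<Sum>u\<in>V. B m u v) + (\<Sum>x\<in>X. B m x v)"
    using split by linarith
  then have "int (\<Sum>u\<in>V. B (Suc m) u v) + int (\<Sum>a\<in>S. B m a v)
      = 1 + 2 * int (\<Sum>u\<in>V. B m u v) + int (\<Sum>x\<in>X. B m x v)"
    by linarith
  then show ?case
    unfolding Suc.IH wt_Suc by (simp add: sum.distrib sum_distrib_left)
qed

text \<open>Geodecity allows a walk for at most one length up to \<open>k\<close>, so at most one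
  term of \<open>wt\<close> survives.\<close>

lemma wt_cases:
  assumes "w \<in> V" "v \<in> V"
  obtains "\<And>j. j \<le> k \<Longrightarrow> W j w v = 0" "wt k w v = 0"
  | j where "j \<le> k" "W j w v = 1" "\<And>i. i \<le> k \<Longrightarrow> i \<noteq> j \<Longrightarrow> W i w v = 0" "wt k w v = 2 ^ (k - j) - 1"
proof (cases "\<forall>j\<le>k. W j w v = 0")
  case True
  then show ?thesis using that(1) by (simp add: wt_def)
next
  case False
  then obtain j where j: "j \<le> k" "W j w v > 0" by auto
  have u: "W j w v = 1" using walks_le_upto[OF j(1), of w v] geodetic[OF assms] j(2) by linarith
  have z: "W i w v = 0" if "i \<le> k" "i \<noteq> j" for i
  proof -
    have "sum (\<lambda>j. W j w v) {i, j} \<le> B k w v"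
      unfolding walks_upto_def using that j by (intro sum_mono2) auto
    with geodetic[OF assms] that u show ?thesis by simp
  qed
  have "wt k w v = (\<Sum>i\<le>k. if i = j then 2 ^ (k - j) - 1 else 0)"
    unfolding wt_def by (rule sum.cong) (auto simp: u z)
  with j u z that(2) show ?thesis by simp
qed

lemma wt_nonneg: "wt m w v \<ge> 0"
  unfolding wt_def by (intro sum_nonneg) auto

text \<open>Each vertex has at most one walk of length at most \<open>k\<close> to \<open>x\<close>,
  so the column sum is at most the order \<open>2 ^ Suc k + 1\<close>. In
  \<open>column_sum_upto\<close> the vertex \<open>x\<close> itself contributes
  \<open>2 ^ k - 1\<close> through its empty walk.\<close>

lemma sum_wt_X_le:
  assumes "x \<in> X"
  shows "2 ^ k - 3 + (\<Sum>y\<in>X - {x}. wt k y x) \<le> (\<Sum>a\<in>S. wt k a x)"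
proof -
  have x: "x \<in> V" using assms X_V by auto
  have "(\<Sum>u\<in>V. B k u x) \<le> (\<Sum>u\<in>V. 1)"
    by (intro sum_mono geodetic x) auto
  then have "int (\<Sum>u\<in>V. B k u x) \<le> int (2 ^ Suc k + 1)"
    using card_V by (simp only: of_nat_le_iff) simp
  moreover have "wt k x x = 2 ^ k - 1"
    using wt_cases[OF x x]
  proof cases
    case (2 j)
    have "W 0 x x = 1" by simp
    then have "j = 0" using 2(3)[of 0] by auto
    then show ?thesis using 2(4) by simp
  qed (use k_ge_3 in force)
  moreover have "(\<Sum>y\<in>X. wt k y x) = wt k x x + (\<Sum>y\<in>X - {x}. wt k y x)"
    using assms finite_X by (rule sum.remove[rotated])
  ultimately show ?thesis using column_sum_upto[OF x, of k] by simp
qed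

section \<open>In-neighbours of a vertex of in-degree 3\<close>

lemma walks_1: "u \<in> V \<Longrightarrow> W (Suc 0) u v = of_bool (v \<in> N u)"
  by (simp add: of_bool_def sum.delta finite_N)

lemma upto_refl: "B m v v > 0"
  using walks_le_upto[of 0 m v v] by simp

lemma upto_children:
  assumes "u \<in> V"
  shows "B k u v = of_bool (u = v) + (\<Sum>w\<in>N u. B (k - 1) w v)"
  using walks_upto_Suc[of "k - 1" u v] k_ge_3 by simp

text \<open>Prefixing arcs from \<open>u\<close> to walks from \<open>w\<close> and
  \<open>w'\<close> would give two walks from \<open>u\<close> to \<open>v\<close> of length at most
  \<open>k\<close>. If \<open>u = v\<close>, the empty walk is the second one.\<close>

lemma upto_child_unique:
  assumes "u \<in> V" "v \<in> V" "w \<in> N u" "w' \<in> N u" "w \<noteq> w'" "B (k - 1) w v > 0"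
  shows "u \<noteq> v" "B (k - 1) w' v = 0"
proof -
  have "of_bool (u = v) + (\<Sum>w\<in>N u. B (k - 1) w v) \<le> 1"
    using geodetic[OF assms(1,2)] upto_children[OF assms(1)] by simp
  moreover have "(\<Sum>w\<in>{w, w'}. B (k - 1) w v) \<le> (\<Sum>w\<in>N u. B (k - 1) w v)"
    using assms finite_N by (intro sum_mono2) auto
  ultimately have "of_bool (u = v) + (B (k - 1) w v + B (k - 1) w' v) \<le> 1"
    using assms(5) by simp
  with assms(6) show "u \<noteq> v" "B (k - 1) w' v = 0"
    by (auto split: if_splits)
qed

lemma upto_edge: "u \<in> V \<Longrightarrow> v \<in> N u \<Longrightarrow> 0 < m \<Longrightarrow> B m u v > 0"
  using walks_le_upto[of "Suc 0" m u v] walks_1[of u v] by simp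

lemma no_loop: "v \<in> V \<Longrightarrow> v \<notin> N v"
  using loop_free[of v "Suc 0"] walks_1[of v v] k_ge_3 by auto

lemma no_transitive_triangle:
  assumes "u \<in> V" "w \<in> N u" "v \<in> N u" shows "v \<notin> N w"
proof
  assume "v \<in> N w"
  have "w \<in> V" "v \<in> V" using assms in_N_V by auto
  then have "w \<noteq> v" using no_loop \<open>v \<in> N w\<close> by auto
  moreover have "B (k - 1) w v > 0"
    using upto_edge[OF \<open>w \<in> V\<close> \<open>v \<in> N w\<close>] k_ge_3 by simp
  ultimately have "B (k - 1) v v = 0"
    using upto_child_unique(2)[of u v w v] assms \<open>v \<in> V\<close> by auto
  then show False using upto_refl[of "k - 1" v] by simp
qed

lemma wt_adjacent:
  assumes "a \<in> V" "x \<in> N a"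
  shows "wt k a x = 2 ^ (k - 1) - 1"
  using wt_cases[OF assms(1) in_N_V[OF assms]]
proof cases
  case 1
  then show ?thesis using 1(1)[of "Suc 0"] walks_1[OF assms(1), of x] assms k_ge_3 by simp
next
  case (2 j)
  have "j = Suc 0"
    using 2(3)[of "Suc 0"] walks_1[OF assms(1), of x] assms k_ge_3 by fastforce
  then show ?thesis using 2 by simp
qed

text \<open>The weight at distance \<open>j\<close> is \<open>2 ^ (k - j) - 1\<close>, so only
  distance 2 attains the first bound. From distance 3 on, \<open>2 ^ (k - 3) - 1\<close> is at most
  \<open>2 ^ (k - 2) - 2\<close>, with equality for \<open>k = 3\<close>.\<close>

lemma wt_not_adjacent:
  assumes "a \<in> V" "x \<in> V" "x \<notin> N a" "a \<noteq> x"
  shows "wt k a x \<le> 2 ^ (k - 2) - 1"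
    and "W 2 a x \<noteq> 1 \<Longrightarrow> wt k a x \<le> 2 ^ (k - 2) - 2"
proof -
  have "k - 2 = Suc (k - 3)" using k_ge_3 by simp
  then have K: "(2::int) ^ (k - 2) = 2 * 2 ^ (k - 3)" "(2::int) ^ (k - 3) \<ge> 1"
    by (simp_all only: power_Suc) simp
  have "wt k a x \<le> 2 ^ (k - 2) - 1 \<and> (W 2 a x \<noteq> 1 \<longrightarrow> wt k a x \<le> 2 ^ (k - 2) - 2)"
    using wt_cases[OF assms(1,2)]
  proof cases
    case 1
    then show ?thesis using K by auto
  next
    case (2 j)
    have "j \<noteq> 0" "j \<noteq> 1" using 2 assms walks_1[OF assms(1), of x] by (auto intro: ccontr)
    then consider "j = 2" | "j \<ge> 3" by linarith
    then show ?thesis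
    proof cases
      case 1
      then show ?thesis using 2 by auto
    next
      case far: 2
      have "(2::int) ^ (k - j) \<le> 2 ^ (k - 3)" using far by (intro power_increasing) auto
      then show ?thesis using 2(4) K by (intro conjI impI; linarith)
    qed
  qed
  then show "wt k a x \<le> 2 ^ (k - 2) - 1"
    and "W 2 a x \<noteq> 1 \<Longrightarrow> wt k a x \<le> 2 ^ (k - 2) - 2" by auto
qed

text \<open>Let \<open>K = 2 ^ (k - 2)\<close>. The vertices of \<open>S\<close> must supply weight
  at least \<open>4 * K - 3\<close>. An in-neighbour of \<open>x\<close> supplies
  \<open>2 * K - 1\<close>, a vertex at distance 2 supplies \<open>K - 1\<close>, any other at most
  \<open>K - 2\<close>. A single in-neighbour in \<open>S\<close> suffices only if every bound is
  tight.\<close>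

lemma in_neighbours_X:
  assumes "x \<in> X"
  obtains a b where "a \<in> S" "b \<in> S" "a \<noteq> b" "x \<in> N a" "x \<in> N b"
  | a where "a \<in> S" "x \<in> N a" "\<And>b. b \<in> S - {a} \<Longrightarrow> x \<notin> N b \<and> W 2 b x = 1"
      "\<And>y. y \<in> X \<Longrightarrow> x \<notin> N y"
proof (cases "\<exists>a\<in>S. \<exists>b\<in>S. a \<noteq> b \<and> x \<in> N a \<and> x \<in> N b")
  case True
  then show ?thesis using that(1) by blast
next
  case False
  define K where "K = (2::int) ^ (k - 2)"
  have "k - 1 = Suc (k - 2)" using k_ge_3 by simp
  then have "(2::int) ^ (k - 1) = 2 * K" unfolding K_def by (simp only: power_Suc)
  moreover have "2 + (k - 2) = k" using k_ge_3 by simp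
  then have "(2::int) ^ k = 2 ^ (2 + (k - 2))" by simp
  ultimately have pw: "(2::int) ^ (k - 1) = 2 * K" "(2::int) ^ k = 4 * K"
    unfolding K_def by (simp_all only: power_add) simp
  have "K \<ge> 2 ^ 1" unfolding K_def using k_ge_3 by (intro power_increasing) auto
  then have K2: "K \<ge> 2" by simp
  have xV: "x \<in> V" and xS: "x \<notin> S" using assms X_V disj by auto
  have low: "wt k b x \<le> K - 1" "W 2 b x \<noteq> 1 \<Longrightarrow> wt k b x \<le> K - 2" if "b \<in> S" "x \<notin> N b" for b
    using wt_not_adjacent[of b x] that xV xS S_V unfolding K_def by auto
  have nn: "(\<Sum>y\<in>X - {x}. wt k y x) \<ge> 0" by (intro sum_nonneg wt_nonneg)
  have main: "4 * K - 3 + (\<Sum>y\<in>X - {x}. wt k y x) \<le> (\<Sum>a\<in>S. wt k a x)"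
    using sum_wt_X_le[OF assms] pw by simp
  \<comment> \<open>Otherwise the total is at most \<open>3 * K - 3\<close>, which is below
    \<open>4 * K - 3\<close>.\<close>
  have "\<exists>a\<in>S. x \<in> N a"
  proof (rule ccontr)
    assume "\<not> ?thesis"
    then have "(\<Sum>a\<in>S. wt k a x) \<le> (\<Sum>a\<in>S. K - 1)" by (intro sum_mono low) auto
    then show False using main nn K2 card_S by simp
  qed
  then obtain a where a: "a \<in> S" "x \<in> N a" by auto
  have oth: "x \<notin> N b" if "b \<in> S - {a}" for b using False a that by auto
  have "card (S - {a}) = 2" using a card_S by simp
  then obtain b c where bc: "S - {a} = {b, c}" "b \<noteq> c" by (auto simp: card_2_iff)
  have "(\<Sum>a\<in>S. wt k a x) = wt k a x + (\<Sum>a\<in>S - {a}. wt k a x)"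
    using a finite_S by (intro sum.remove) auto
  also have "\<dots> = 2 * K - 1 + wt k b x + wt k c x"
    using bc wt_adjacent[of a x] a S_V pw by auto
  finally have eq: "4 * K - 3 + (\<Sum>y\<in>X - {x}. wt k y x) \<le> 2 * K - 1 + wt k b x + wt k c x"
    using main by simp
  have b: "b \<in> S" "x \<notin> N b" and c: "c \<in> S" "x \<notin> N c" using bc oth by auto
  \<comment> \<open>Even with \<open>K - 1\<close> from both \<open>b\<close> and \<open>c\<close>
    the required weight is only just reached, leaving no room for weight from
    \<open>X - {x}\<close>.\<close>
  have "W 2 b x = 1" "W 2 c x = 1" and z: "(\<Sum>y\<in>X - {x}. wt k y x) = 0"
    using eq nn low[OF b] low[OF c] by linarith+
  then have "\<And>b. b \<in> S - {a} \<Longrightarrow> x \<notin> N b \<and> W 2 b x = 1"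
    using bc oth by auto
  moreover have "x \<notin> N y" if "y \<in> X" for y
  proof
    assume xy: "x \<in> N y"
    then have "y \<noteq> x" using no_loop xV by auto
    then have "wt k y x = 0"
      using z finite_X that by (simp add: sum_nonneg_eq_0_iff wt_nonneg)
    moreover have "wt k y x = 2 * K - 1" using wt_adjacent[of y x] xy that X_V pw by auto
    ultimately show False using K2 by simp
  qed
  ultimately show ?thesis using that(2) a by blast
qed

end

lemma card_2_obtain_other:
  assumes "card A = 2" "x \<in> A"
  obtains y where "A = {x, y}" "y \<noteq> x"
  using assms unfolding card_2_iff by (metis insert_commute insertE singletonD)

lemma card_2_subset_three:
  assumes "card A = 2" "A \<subseteq> {a, b, c}"
  shows "A = {b, c} \<or> A = {a, c} \<or> A = {a, b}"
proof -
  obtain x y where A: "A = {x, y}" "x \<noteq> y" using assms(1) by (auto simp: card_2_iff)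
  then have "x \<in> {a, b, c}" "y \<in> {a, b, c}" using assms(2) by auto
  with A(2) show ?thesis unfolding A(1) by (elim insertE emptyE) (simp_all add: insert_commute)
qed

section \<open>Outlier sets inside \<open>S\<close>, and the first configuration\<close>

context excess_two_near_regular
begin

lemma outliers_V: "v \<in> outliers u \<Longrightarrow> v \<in> V"
  by (simp add: outliers_def)

lemma outliers_covered:
  assumes "w \<in> V" "x \<in> X" shows "\<exists>u\<in>outliers w. x \<in> N u"
proof -
  obtain r where "(\<Sum>u\<in>outliers w. mset_set (N u)) = mset_set X + {#r#}"
    using replacement[OF assms(1)] by metis
  then have "x \<in># (\<Sum>u\<in>outliers w. mset_set (N u))"
    using assms(2) finite_X by simp
  then show ?thesis
    using finite_outliers finite_N outliers_V by (auto simp: set_mset_sum)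
qed

lemma pred_exists:
  assumes "v \<in> V" obtains u where "u \<in> V" "v \<in> N u"
proof -
  have "card (preds v) > 0" using indegree[OF assms] by (cases "v \<in> S") auto
  then have "preds v \<noteq> {}" by auto
  then show thesis using that by (auto simp: preds_def)
qed

text \<open>Either identity of \<open>replacement\<close> determines \<open>r\<close>, so an
  \<open>r\<close> read off from the outliers of \<open>u\<close> also serves for the outlier sets
  of its out-neighbours.\<close>

lemma replacement_outliers:
  assumes "u \<in> V" "(\<Sum>p\<in>outliers u. mset_set (N p)) = mset_set X + {#r#}"
  shows "(\<Sum>w\<in>N u. mset_set (outliers w)) = mset_set S + {#r#}"
  using replacement[OF assms(1)] assms(2) by (metis add_left_cancel add_mset_eq_single add_mset_add_single)

lemma outliers_subset:
  assumes "u \<in> V" "w \<in> N u" "(\<Sum>p\<in>outliers u. mset_set (N p)) = mset_set X + {#r#}"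
  shows "outliers w \<subseteq> insert r S"
proof -
  have "set_mset (\<Sum>w\<in>N u. mset_set (outliers w)) = insert r S"
    using replacement_outliers[OF assms(1,3)] finite_S by simp
  then show ?thesis
    using assms(1,2) finite_N finite_outliers by (auto simp: set_mset_sum)
qed

lemma replacement_in_outliers:
  assumes "u \<in> V" "(\<Sum>p\<in>outliers u. mset_set (N p)) = mset_set X + {#r#}"
  shows "\<exists>w\<in>N u. r \<in> outliers w"
proof -
  have "set_mset (\<Sum>w\<in>N u. mset_set (outliers w)) = insert r S"
    using replacement_outliers[OF assms] finite_S by simp
  then show ?thesis
    using assms(1) finite_N finite_outliers by (auto simp: set_mset_sum)
qed

text \<open>Take an in-neighbour \<open>u\<close> of \<open>w\<close> and its other out-neighbour
  \<open>w'\<close>: the outlier sets of \<open>w\<close> and \<open>w'\<close> add up to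
  \<open>S + r\<close>. If the first is not inside \<open>S\<close>, it uses up \<open>r\<close> and
  one \<open>s\<close>, leaving \<open>S - {s}\<close> for \<open>w'\<close>.\<close>

lemma outliers_cases:
  assumes "w \<in> V"
  obtains "outliers w \<subseteq> S"
  | s r w' where "s \<in> S" "r \<notin> S" "outliers w = {s, r}" "w' \<in> V" "outliers w' = S - {s}"
proof (cases "outliers w \<subseteq> S")
  case False
  obtain u where u: "u \<in> V" "w \<in> N u" using pred_exists[OF assms] .
  obtain r where r: "(\<Sum>w\<in>N u. mset_set (outliers w)) = mset_set S + {#r#}"
    using replacement[OF u(1)] by metis
  obtain w' where w': "N u = {w, w'}" "w \<noteq> w'"
    using card_2_obtain_other[OF card_N[OF u(1)] u(2)] by metis
  then have w'V: "w' \<in> V" using u in_N_V by auto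
  have sum: "mset_set (outliers w) + mset_set (outliers w') = mset_set S + {#r#}"
    using r w' by simp
  have cnt: "of_bool (v \<in> outliers w) + of_bool (v \<in> outliers w') = of_bool (v \<in> S) + (of_bool (v = r) :: nat)" for v
  proof -
    have "count (mset_set (outliers w) + mset_set (outliers w')) v = count (mset_set S + {#r#}) v"
      by (rule arg_cong[OF sum])
    then show ?thesis
      by (simp add: count_mset_set' finite_S finite_outliers of_bool_def)
  qed
  have sub: "v \<in> outliers w \<or> v \<in> outliers w' \<Longrightarrow> v \<in> S \<or> v = r" for v
    using cnt[of v] by (cases "v \<in> S"; cases "v = r") auto
  then have rw: "r \<in> outliers w" "r \<notin> S" using False by auto
  then have rw': "r \<notin> outliers w'" using cnt[of r] by auto
  obtain s where s: "outliers w = {s, r}" "s \<noteq> r"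
    using card_2_obtain_other[OF card_outliers[OF assms] rw(1)] by (metis insert_commute)
  then have sS: "s \<in> S" using sub by auto
  then have "s \<notin> outliers w'" using cnt[of s] s by auto
  then have "outliers w' \<subseteq> S - {s}" using sub rw' by auto
  then have "outliers w' = S - {s}"
    using sS card_S card_outliers[OF w'V] finite_S by (intro card_subset_eq) auto
  then show thesis using that(2) sS rw s w'V by auto
qed (use that in auto)

lemma outliers_in_S:
  obtains w where "w \<in> V" "outliers w \<subseteq> S"
proof -
  have "V \<noteq> {}" using card_V by auto
  then obtain w where w: "w \<in> V" by auto
  show thesis
    by (rule outliers_cases[OF w]) (use w that in \<open>metis Diff_subset\<close>)+
qed

text \<open>Since \<open>N b\<close> and \<open>N c\<close> share \<open>x\<close>, the replacement
  vertex of \<open>w\<close> is \<open>x\<close>, so \<open>x\<close> is an outlier of some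
  out-neighbour \<open>w'\<close> of \<open>w\<close>. Covering \<open>X\<close> from the outliers
  of \<open>w'\<close> then forces an arc from \<open>x\<close> into \<open>X\<close>.\<close>

lemma no_six_arcs_aux:
  assumes S: "S = {a, b, c}" and X: "X = {x, y, z}"
    and N: "N a = {y, z}" "N b = {x, z}" "N c = {x, y}"
    and w: "w \<in> V" "outliers w = {b, c}"
  shows False
proof -
  have dS: "a \<noteq> b" "a \<noteq> c" "b \<noteq> c" and dX: "x \<noteq> y" "x \<noteq> z" "y \<noteq> z"
    using card_S card_X unfolding S X by (auto simp: card_insert_if split: if_splits)
  have m: "(\<Sum>p\<in>outliers w. mset_set (N p)) = mset_set X + {#x#}"
    using dS dX by (simp add: w N X)
  obtain w' where w': "w' \<in> N w" "x \<in> outliers w'"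
    using replacement_in_outliers[OF w(1) m] by auto
  have w'V: "w' \<in> V" using w w' in_N_V by auto
  obtain s where s: "outliers w' = {x, s}" "s \<noteq> x"
    using card_2_obtain_other[OF card_outliers[OF w'V] w'(2)] .
  have "s \<in> S" using outliers_subset[OF w(1) w'(1) m] s by auto
  moreover have "\<forall>v\<in>X. v \<in> N x \<or> v \<in> N s"
    using outliers_covered[OF w'V] s by auto
  then have "x \<in> N x \<or> x \<in> N s" "y \<in> N x \<or> y \<in> N s" "z \<in> N x \<or> z \<in> N s"
    by (simp_all add: X)
  \<comment> \<open>\<open>N s\<close> misses exactly one vertex of \<open>X\<close>, which must
    therefore be an out-neighbour of \<open>x\<close>.\<close>
  ultimately consider "x \<in> N x" | "y \<in> N x" | "z \<in> N x"
    using N dX S by auto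
  then show False
  proof cases
    case 1
    then show False using no_loop X X_V by auto
  next
    case 2
    then show False using no_transitive_triangle[of c x y] N S S_V by auto
  next
    case 3
    then show False using no_transitive_triangle[of b x z] N S S_V by auto
  qed
qed

lemma no_six_arcs:
  assumes S: "S = {a, b, c}" and X: "X = {x, y, z}"
    and N: "N a = {y, z}" "N b = {x, z}" "N c = {x, y}"
  shows False
proof -
  obtain w where w: "w \<in> V" "outliers w \<subseteq> S" by (rule outliers_in_S)
  have "card (outliers w) = 2" using w card_outliers by auto
  then consider "outliers w = {b, c}" | "outliers w = {a, c}" | "outliers w = {a, b}"
    using w(2) card_2_subset_three[of "outliers w" a b c] unfolding S by blast
  then show False
  proof cases
    case 1
    then show False using no_six_arcs_aux[OF S X N w(1)] by simp
  next
    case 2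
    then show False using no_six_arcs_aux[of b a c y x z w] S X N w(1) by (simp add: insert_commute)
  next
    case 3
    then show False using no_six_arcs_aux[of c a b z x y w] S X N w(1) by (simp add: insert_commute)
  qed
qed

section \<open>The second configuration: alternating levels below \<open>x3\<close>\<close>

lemma card_level:
  assumes "u \<in> V" "j \<le> k"
  shows "card {v \<in> V. W j u v > 0} = 2 ^ j"
proof -
  have le: "W j u v \<le> 1" if "v \<in> V" for v
    using walks_le_upto[OF assms(2), of u v] geodetic[OF assms(1) that] by linarith
  have "(2::nat) ^ j = (\<Sum>v\<in>V. of_bool (W j u v > 0))"
    unfolding sum_walks[OF assms(1), symmetric]
    by (rule sum.cong) (use le in \<open>force simp: of_bool_def le_Suc_eq\<close>)+
  then show ?thesis using finite_V by (simp add: Int_def)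
qed

lemma walks_append:
  assumes "u \<in> V" "v \<in> V" "v' \<in> N v"
  shows "W j u v \<le> W (Suc j) u v'"
proof -
  have v': "v' \<in> V" using assms in_N_V by auto
  have "W j u v \<le> (\<Sum>w\<in>preds v'. W j u w)"
    using assms finite_preds by (intro member_le_sum) (auto simp: preds_def)
  then show ?thesis using sum_N_preds[OF assms(1) v', of j] by simp
qed

lemma walks_levels_disjoint:
  assumes "u \<in> V" "v \<in> V" "i \<le> k" "j \<le> k" "i \<noteq> j" "W i u v > 0"
  shows "W j u v = 0"
proof -
  have "sum (\<lambda>j. W j u v) {i, j} \<le> B k u v"
    unfolding walks_upto_def using assms by (intro sum_mono2) auto
  with geodetic[OF assms(1,2)] assms show ?thesis by simp
qed

lemma no_three_arcs:
  assumes S: "S = {a1, a2, a3}" and X: "X = {x1, x2, x3}"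
    and N1: "N a1 = {x1, x2}" and N2: "N a2 = {x3, z2}" and N3: "N a3 = {x3, z3}"
    and Nz2: "N z2 = {x1, x2}" and Nz3: "N z3 = {x1, x2}"
    and z: "z2 \<notin> X" "z3 \<notin> X"
  shows False
proof -
  have dS: "a1 \<noteq> a2" "a1 \<noteq> a3" "a2 \<noteq> a3" and dX: "x1 \<noteq> x2" "x1 \<noteq> x3" "x2 \<noteq> x3"
    using card_S card_X unfolding S X by (auto simp: card_insert_if split: if_splits)
  have V: "a1 \<in> V" "a2 \<in> V" "a3 \<in> V" "x1 \<in> V" "x2 \<in> V" "x3 \<in> V"
    using S S_V X X_V by auto
  have zV: "z2 \<in> V" "z3 \<in> V" using in_N_V[OF V(2)] in_N_V[OF V(3)] N2 N3 by auto
  have zX: "z2 \<noteq> x1" "z2 \<noteq> x2" "z2 \<noteq> x3" "z3 \<noteq> x1" "z3 \<noteq> x2" "z3 \<noteq> x3" using z X by auto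
  have za: "z2 \<notin> {a2, a3}" "z3 \<notin> {a2, a3}" using Nz2 Nz3 N2 N3 dX by auto
  define zf where "zf l = (if l = a2 then z2 else z3)" for l
  have cov: "\<exists>u\<in>outliers w. v \<in> N u" if "w \<in> V" "v \<in> {x1, x2, x3}" for w v
    using outliers_covered[OF that(1)] that(2) X by auto
  have not23: "outliers w \<noteq> {a2, a3}" if "w \<in> V" for w
    using cov[OF that, of x1] N2 N3 dX zX by auto
  \<comment> \<open>In the second case of \<open>outliers_cases\<close>, \<open>s = a1\<close> is
    impossible because the companion set would be \<open>{a2, a3}\<close>. As \<open>a2\<close> and
    \<open>a3\<close> have only \<open>x3\<close> in common with \<open>X\<close>, the other outlier
    must supply \<open>x1\<close> and \<open>x2\<close>.\<close>
  have claim1: "\<exists>l q. l \<in> {a2, a3} \<and> q \<in> V \<and> outliers w = {l, q} \<and> N q = {x1, x2}" if w: "w \<in> V" for w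
    using w
  proof (rule outliers_cases)
    assume "outliers w \<subseteq> S"
    then have "outliers w = {a1, a3} \<or> outliers w = {a1, a2}"
      using card_2_subset_three[of "outliers w" a1 a2 a3] card_outliers[OF w] not23[OF w] S by auto
    then show ?thesis using N1 V(1) by (auto simp: insert_commute)
  next
    fix s r w' assume sr: "s \<in> S" "r \<notin> S" "outliers w = {s, r}" "w' \<in> V" "outliers w' = S - {s}"
    have "s \<noteq> a1" using not23[OF sr(4)] sr(5) S dS by auto
    then have s: "s = a2 \<or> s = a3" using sr(1) S by auto
    then have "x1 \<notin> N s" "x2 \<notin> N s" using N2 N3 dX zX by auto
    then have "{x1, x2} \<subseteq> N r" using cov[OF w, of x1] cov[OF w, of x2] sr(3) by auto
    moreover have r: "r \<in> V" using sr(3) outliers_V by auto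
    ultimately have "N r = {x1, x2}"
      using card_N[OF r] finite_N[OF r] dX by (intro card_subset_eq[symmetric]) auto
    then show ?thesis using s sr(3) r by auto
  qed
  \<comment> \<open>\<open>N l\<close> and \<open>N q\<close> add up to \<open>X + zf l\<close>, so
    \<open>zf l\<close> is the replacement vertex of \<open>u\<close>.\<close>
  have claim2: "outliers w \<subseteq> insert (zf l) S" if u: "u \<in> V" "w \<in> N u" "l \<in> {a2, a3}" "l \<in> outliers u" for u w l
  proof -
    obtain l' q where l': "l' \<in> {a2, a3}" "outliers u = {l', q}" "N q = {x1, x2}"
      using claim1[OF u(1)] by auto
    have q: "q \<notin> {a2, a3}" using l'(3) N2 N3 dX by auto
    then have "outliers u = {l, q}" "l \<noteq> q" using u(3,4) l' by auto
    moreover have "N l = {x3, zf l}" using u(3) N2 N3 by (auto simp: zf_def)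
    moreover have "zf l \<noteq> x3" using zX by (simp add: zf_def)
    ultimately have "(\<Sum>p\<in>outliers u. mset_set (N p)) = mset_set X + {#zf l#}"
      using l'(3) dX by (simp add: X)
    then show ?thesis using outliers_subset u by blast
  qed
  \<comment> \<open>For an in-neighbour \<open>u\<close> of \<open>w\<close>, the vertex
    \<open>q\<close> lies in \<open>S\<close> or is the replacement vertex of \<open>u\<close>,
    which is \<open>z2\<close> or \<open>z3\<close>.\<close>
  have claim3: "\<exists>l q. l \<in> {a2, a3} \<and> q \<in> {a1, z2, z3} \<and> outliers w = {l, q}" if w: "w \<in> V" for w
  proof -
    obtain l q where l: "l \<in> {a2, a3}" "outliers w = {l, q}" "N q = {x1, x2}"
      using claim1[OF w] by auto
    obtain u where u: "u \<in> V" "w \<in> N u" using pred_exists[OF w] .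
    obtain l' where l': "l' \<in> {a2, a3}" "l' \<in> outliers u"
      using claim1[OF u(1)] by auto
    have "q \<in> insert (zf l') S" using claim2[OF u l'] l(2) by auto
    moreover have "q \<notin> {a2, a3}" using l(3) N2 N3 dX by auto
    ultimately have "q \<in> {a1, z2, z3}" using S by (auto simp: zf_def split: if_splits)
    then show ?thesis using l by blast
  qed
  \<comment> \<open>\<open>x3\<close> and \<open>z2\<close> are the out-neighbours of
    \<open>a2\<close>, so no vertex is within \<open>k - 1\<close> of both; likewise for
    \<open>x3\<close> and \<open>z3\<close> below \<open>a3\<close>.\<close>
  have near2: "v \<noteq> a2" "v \<noteq> a3" "v \<noteq> z2" "v \<noteq> z3" "B (k - 1) z2 v = 0"
    if v: "v \<in> V" "B (k - 1) x3 v > 0" for v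
  proof -
    show "v \<noteq> a2" "B (k - 1) z2 v = 0"
      using upto_child_unique[OF V(2) v(1), of x3 z2] N2 zX v(2) by auto
    then show "v \<noteq> z2" using upto_refl[of "k - 1" v] by auto
    have "v \<noteq> a3" "B (k - 1) z3 v = 0"
      using upto_child_unique[OF V(3) v(1), of x3 z3] N3 zX v(2) by auto
    then show "v \<noteq> a3" "v \<noteq> z3" using upto_refl[of "k - 1" v] by auto
  qed
  have child_not_outlier: "v \<notin> outliers u" if "u \<in> V" "w \<in> N u" "B (k - 1) w v > 0" for u v w
  proof -
    have "B (k - 1) w v \<le> (\<Sum>w\<in>N u. B (k - 1) w v)"
      using that finite_N by (intro member_le_sum) auto
    then show ?thesis using upto_children[OF that(1), of v] that(3) by (simp add: outliers_def)
  qed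
  have self_not_outlier: "v \<notin> outliers v" for v
    using upto_refl[of k v] by (simp add: outliers_def)
  \<comment> \<open>Otherwise \<open>a3\<close> is an outlier of \<open>a2\<close> and
    \<open>a2\<close> one of \<open>a3\<close>. As \<open>x3\<close> is an out-neighbour of both,
    \<open>claim2\<close> puts its outliers in \<open>S + z3\<close> and in \<open>S + z2\<close>.
    This leaves only \<open>q = a1\<close> in \<open>claim3\<close>, yet \<open>x3\<close> reaches
    \<open>a1\<close>.\<close>
  have near1: "B (k - 1) x3 a1 = 0"
  proof (rule ccontr)
    assume "B (k - 1) x3 a1 \<noteq> 0"
    then have pos: "B (k - 1) x3 a1 > 0" by simp
    then have a1x: "a1 \<notin> outliers x3"
      using walks_upto_mono[of "k - 1" k x3 a1] by (simp add: outliers_def)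
    have "a1 \<notin> outliers a2" "a2 \<notin> outliers a2" "z2 \<notin> outliers a2"
      using child_not_outlier[OF V(2) _ pos] child_not_outlier[OF V(2) _ upto_refl, of z2] N2 self_not_outlier by auto
    then have o2: "a3 \<in> outliers a2" "z3 \<in> outliers a2" and z23: "z2 \<noteq> z3"
      using claim3[OF V(2)] by auto
    have "a1 \<notin> outliers a3" "a3 \<notin> outliers a3" "z3 \<notin> outliers a3"
      using child_not_outlier[OF V(3) _ pos] child_not_outlier[OF V(3) _ upto_refl, of z3] N3 self_not_outlier by auto
    then have o3: "a2 \<in> outliers a3"
      using claim3[OF V(3)] by auto
    have "outliers x3 \<subseteq> insert z3 S" "outliers x3 \<subseteq> insert z2 S"
      using claim2[OF V(2), of x3 a3] claim2[OF V(3), of x3 a2] o2 o3 N2 N3 dS by (auto simp: zf_def)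
    moreover obtain l q where "outliers x3 = {l, q}" "q \<in> {a1, z2, z3}" using claim3[OF V(6)] by blast
    ultimately show False using a1x S za z23 by auto
  qed
  \<comment> \<open>\<open>v\<close> is no outlier of \<open>a1\<close>, so it is within
    \<open>k - 1\<close> of exactly one of \<open>x1\<close> and \<open>x2\<close>. It cannot be
    within \<open>k - 2\<close>, since the arcs from \<open>z2\<close> would then bring it within
    \<open>k - 1\<close> of \<open>z2\<close>.\<close>
  have split: "W (k - 1) x1 v + W (k - 1) x2 v = 1" if v: "v \<in> V" "B (k - 1) x3 v > 0" for v
  proof -
    have va: "v \<noteq> a1" using near1 v(2) by auto
    obtain l q where lq: "l \<in> {a2, a3}" "q \<in> {a1, z2, z3}" "outliers a1 = {l, q}"
      using claim3[OF V(1)] by auto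
    have "v \<notin> outliers a1"
      using lq near2[OF v] va self_not_outlier by auto
    then have "B k a1 v = 1" using upto_eq[OF V(1) v(1)] by simp
    then have 1: "B (k - 1) x1 v + B (k - 1) x2 v = 1"
      using upto_children[OF V(1), of v] va N1 dX by auto
    have k: "k - 1 = Suc (k - 2)" using k_ge_3 by simp
    have "B (k - 2) x1 v + B (k - 2) x2 v = 0"
      using near2(5)[OF v] walks_upto_Suc[of "k - 2" z2 v] Nz2 dX unfolding k by simp
    then show ?thesis using 1 unfolding k walks_upto_def by simp
  qed
  have alternate: "W (k - 1) x1 v' = 1 - W (k - 1) x1 v"
    if v: "v \<in> V" "B (k - 1) x3 v > 0" and v': "v' \<in> N v" "B (k - 1) x3 v' > 0" for v v'
  proof -
    have v'V: "v' \<in> V" using v v' in_N_V by auto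
    have k: "k = Suc (k - 1)" using k_ge_3 by simp
    \<comment> \<open>A walk of length \<open>k - 1\<close> to \<open>v\<close> extends to one of
      length \<open>k\<close> to \<open>v'\<close>, which excludes one of length
      \<open>k - 1\<close>.\<close>
    have z: "W (k - 1) y v' = 0" if "W (k - 1) y v > 0" "y \<in> V" for y
    proof -
      have "W k y v' > 0" using walks_append[OF that(2) v(1) v'(1), of "k - 1"] that(1) k by simp
      then show ?thesis using walks_levels_disjoint[of y v' k "k - 1"] that v'V k_ge_3 by simp
    qed
    show ?thesis
      using z[OF _ V(4)] z[OF _ V(5)] split[OF v] split[OF v'V v'(2)]
      by (cases "W (k - 1) x1 v = 0") linarith+
  qed
  define L where "L j = {v \<in> V. W j x3 v > 0}" for j
  have L_upto: "B (k - 1) x3 v > 0" if "v \<in> L j" "j \<le> k - 1" for v j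
    using that walks_le_upto[of j "k - 1" x3 v] by (simp add: L_def)
  have colour: "W (k - 1) x1 v = (if even j then W (k - 1) x1 x3 else 1 - W (k - 1) x1 x3)"
    if "v \<in> L j" "j \<le> k - 1" for v j
    using that
  proof (induction j arbitrary: v)
    case 0
    then show ?case by (simp add: L_def)
  next
    case (Suc j)
    then have v: "v \<in> V" "W (Suc j) x3 v > 0" by (auto simp: L_def)
    then have "(\<Sum>w\<in>preds v. W j x3 w) > 0" using sum_N_preds[OF V(6) v(1), of j] by simp
    then obtain w where w: "w \<in> preds v" "W j x3 w > 0"
      by (metis gr0I less_irrefl sum.neutral)
    then have wL: "w \<in> L j" "v \<in> N w" "w \<in> V" by (auto simp: L_def preds_def)
    \<comment> \<open>This bound makes \<open>1 - (1 - c) = c\<close> valid for subtraction of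
      naturals.\<close>
    have "W (k - 1) x1 x3 \<le> 1" using split[OF V(6)] upto_refl[of "k - 1" x3] by simp
    with alternate[OF wL(3) L_upto[OF wL(1)] wL(2) L_upto[OF Suc.prems]] Suc.IH[OF wL(1)] Suc.prems(2)
    show ?case by (auto split: if_splits)
  qed
  have par: "even (k - 1) \<longleftrightarrow> even (k - 3)" using k_ge_3 by presburger
  have le: "k - 1 \<le> k - 1" "k - 3 \<le> k - 1" by simp_all
  have disjL: "L (k - 1) \<inter> L (k - 3) = {}"
    using walks_levels_disjoint[OF V(6), of _ "k - 1" "k - 3"] k_ge_3 by (auto simp: L_def)
  have cardL: "card (L j) = 2 ^ j" if "j \<le> k" for j
    using card_level[OF V(6) that] by (simp add: L_def)
  have finL: "finite (L j)" for j using finite_V by (simp add: L_def)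
  \<comment> \<open>By parity both levels have the same colour, which decides whether
    \<open>y\<close> is \<open>x1\<close> or \<open>x2\<close>. Together they have
    \<open>2 ^ (k - 1) + 2 ^ (k - 3)\<close> vertices, but only \<open>2 ^ (k - 1)\<close> walks of
    length \<open>k - 1\<close> leave \<open>y\<close>.\<close>
  obtain y where y: "y \<in> V" "\<And>v. v \<in> L (k - 1) \<union> L (k - 3) \<Longrightarrow> W (k - 1) y v = 1"
  proof (cases "(if even (k - 1) then W (k - 1) x1 x3 else 1 - W (k - 1) x1 x3) = 1")
    case True
    have "W (k - 1) x1 v = 1" if "v \<in> L (k - 1) \<union> L (k - 3)" for v
      using that colour[OF _ le(1), of v] colour[OF _ le(2), of v] par True by (auto simp del: One_nat_def)
    then show thesis using that V by blast
  next
    case False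
    have "W (k - 1) x2 v = 1" if v: "v \<in> L (k - 1) \<union> L (k - 3)" for v
    proof -
      have "v \<in> V" "B (k - 1) x3 v > 0"
        using v L_upto[OF _ le(1), of v] L_upto[OF _ le(2), of v] by (auto simp: L_def)
      from split[OF this] show ?thesis
        using v colour[OF _ le(1), of v] colour[OF _ le(2), of v] par False
        by (auto simp del: One_nat_def split: if_splits)
    qed
    then show thesis using that V by blast
  qed
  have "card (L (k - 1) \<union> L (k - 3)) = (\<Sum>v\<in>L (k - 1) \<union> L (k - 3). W (k - 1) y v)"
    using y by simp
  also have "\<dots> \<le> (\<Sum>v\<in>V. W (k - 1) y v)"
    using finite_V by (intro sum_mono2) (auto simp: L_def)
  also have "\<dots> = card (L (k - 1))" using sum_walks[OF y(1)] cardL by simp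
  finally have "card (L (k - 3)) = 0"
    using card_Un_disjoint[OF finL finL disjL] by simp
  then show False using cardL[of "k - 3"] by simp
qed

section \<open>Reduction to the two configurations\<close>

lemma walks_2_middle:
  assumes "u \<in> V" "W 2 u v = 1" obtains w where "w \<in> N u" "v \<in> N w"
proof -
  have "(\<Sum>w\<in>N u. W (Suc 0) w v) = 1" using assms(2) by (simp add: numeral_2_eq_2)
  then obtain w where "w \<in> N u" "W (Suc 0) w v \<noteq> 0"
    by (metis sum.neutral zero_neq_one)
  then show thesis using that walks_1[of w v] in_N_V[OF assms(1)] by auto
qed

text \<open>In the first case of \<open>in_neighbours_X\<close> the two in-neighbours are all of
  \<open>S - {a}\<close>. In the second, \<open>a\<close> would reach \<open>x\<close> through a
  vertex of \<open>N a\<close>, hence of \<open>X\<close>, but \<open>x\<close> has no in-neighbour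
  in \<open>X\<close>.\<close>

lemma S_preds_of_missed:
  assumes "a \<in> S" "N a \<subseteq> X" "x \<in> X" "x \<notin> N a" "b \<in> S" "b \<noteq> a"
  shows "x \<in> N b"
  using assms(3)
proof (rule in_neighbours_X)
  fix c d assume "c \<in> S" "d \<in> S" "c \<noteq> d" "x \<in> N c" "x \<in> N d"
  moreover have "card (S - {a}) = 2" using assms(1) card_S by simp
  then have "S - {a} \<subseteq> {c, d}" if "{c, d} \<subseteq> S - {a}" "c \<noteq> d"
    using that by (metis card_2_iff card_subset_eq finite.emptyI finite_insert finite_Diff finite_S order_refl)
  ultimately show ?thesis using assms by auto
next
  fix c assume c: "c \<in> S" "x \<in> N c" "\<And>b. b \<in> S - {c} \<Longrightarrow> x \<notin> N b \<and> W 2 b x = 1"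
    "\<And>y. y \<in> X \<Longrightarrow> x \<notin> N y"
  then have "W 2 a x = 1" "a \<in> V" using assms S_V by auto
  then obtain y where "y \<in> N a" "x \<in> N y" using walks_2_middle by metis
  then show ?thesis using c(4) assms(2) by auto
qed

text \<open>The third vertex \<open>c\<close> of \<open>S\<close> is adjacent to the vertices of
  \<open>X\<close> missed by \<open>a\<close> and by \<open>b\<close>, which yields the first
  configuration.\<close>

lemma two_full_False:
  assumes a: "a \<in> S" "N a \<subseteq> X" and b: "b \<in> S" "N b \<subseteq> X" and "a \<noteq> b"
  shows False
proof -
  obtain c where S: "S = {a, b, c}" "c \<noteq> a" "c \<noteq> b"
  proof -
    have "card (S - {a}) = 2" "b \<in> S - {a}" using assms card_S by auto
    then obtain c where "S - {a} = {b, c}" "c \<noteq> b" by (rule card_2_obtain_other)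
    then show thesis using that[of c] a by auto
  qed
  obtain y z where y: "N a = {y, z}" "y \<noteq> z" using a S_V by (metis N_two subsetD)
  obtain x where X: "X = {x, y, z}" "x \<noteq> y" "x \<noteq> z"
  proof -
    have "card (X - {y}) = 2" "z \<in> X - {y}" using y a card_X by auto
    then obtain x where "X - {y} = {z, x}" "x \<noteq> z" by (rule card_2_obtain_other)
    then show thesis using that[of x] a y by auto
  qed
  have x: "x \<in> N b" "x \<in> N c"
    using S_preds_of_missed[OF a, of x] X y S assms(5) by auto
  have card: "card (N b) = 2" "card (N c) = 2" using S S_V card_N by auto
  obtain w where w: "N b = {x, w}" "w \<noteq> x" using card_2_obtain_other[OF card(1) x(1)] .
  obtain v where v: "N c = {x, v}" "v \<noteq> x" using card_2_obtain_other[OF card(2) x(2)] .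
  have "w = y \<or> w = z" using w b X by auto
  then show False
  proof
    assume [simp]: "w = y"
    have "z \<in> N c" using S_preds_of_missed[OF b, of z] w X y S by auto
    then have "N c = {x, z}" using v X by auto
    then show False using no_six_arcs[of a b c x z y] S X y w by (simp add: insert_commute)
  next
    assume [simp]: "w = z"
    have "y \<in> N c" using S_preds_of_missed[OF b, of y] w X y S by auto
    then have "N c = {x, y}" using v X by auto
    then show False using no_six_arcs[of a b c x y z] S X y w by simp
  qed
qed

lemma no_near_regular_excess_two: False
proof -
  obtain w where w: "w \<in> V" "outliers w \<subseteq> S" by (rule outliers_in_S)
  obtain p q where pq: "outliers w = {p, q}"
    using card_outliers[OF w(1)] by (auto simp: card_2_iff)
  \<comment> \<open>Two out-neighbourhoods cover the three vertices of \<open>X\<close>, so one of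
    them has both its elements in \<open>X\<close>.\<close>
  have "\<exists>a\<in>{p, q}. N a \<subseteq> X"
  proof (rule ccontr)
    assume neg: "\<not> ?thesis"
    have "card (N a \<inter> X) \<le> 1" if "a \<in> {p, q}" for a
    proof -
      have a: "a \<in> V" using that pq w S_V by auto
      have "N a \<inter> X \<subset> N a" using neg that by auto
      then have "card (N a \<inter> X) < card (N a)" using finite_N[OF a] by (rule psubset_card_mono[rotated])
      then show ?thesis using card_N[OF a] by simp
    qed
    then have "card (N p \<inter> X) \<le> 1" "card (N q \<inter> X) \<le> 1" by auto
    moreover have "(N p \<inter> X) \<union> (N q \<inter> X) = X"
      using outliers_covered[OF w(1)] pq by auto
    then have "card X \<le> card (N p \<inter> X) + card (N q \<inter> X)"
      using card_Un_le[of "N p \<inter> X" "N q \<inter> X"] by simp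
    ultimately show False using card_X by linarith
  qed
  then obtain a1 where a1: "a1 \<in> S" "N a1 \<subseteq> X" using w pq by auto
  have "card (S - {a1}) = 2" using a1 card_S by simp
  then obtain a2 a3 where a23: "S - {a1} = {a2, a3}" "a2 \<noteq> a3" by (auto simp: card_2_iff)
  then have S: "S = {a1, a2, a3}" "a2 \<noteq> a1" "a3 \<noteq> a1" using a1 by auto
  then have V: "a1 \<in> V" "a2 \<in> V" "a3 \<in> V" using S_V by auto
  obtain x1 x2 where N1: "N a1 = {x1, x2}" "x1 \<noteq> x2" using V by (metis N_two)
  have "card (X - {x1}) = 2" "x2 \<in> X - {x1}" using N1 a1 card_X by auto
  then obtain x3 where x3: "X - {x1} = {x2, x3}" "x3 \<noteq> x2" by (rule card_2_obtain_other)
  then have X: "X = {x1, x2, x3}" "x3 \<noteq> x1" using a1 N1 by auto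
  have N23: "\<exists>z. N a = {x3, z} \<and> z \<notin> X \<and> N z = {x1, x2}" if a: "a = a2 \<or> a = a3" for a
  proof -
    have aS: "a \<in> S" "a \<noteq> a1" "a \<in> V" using a S V by auto
    have "x3 \<in> N a" using S_preds_of_missed[OF a1, of x3 a] aS X x3 N1 by auto
    with card_N[OF aS(3)] obtain z where z: "N a = {x3, z}" "z \<noteq> x3" by (rule card_2_obtain_other)
    have zX: "z \<notin> X" using two_full_False[OF a1, of a] z aS X by auto
    have zV: "z \<in> V" using in_N_V[OF aS(3)] z by auto
    have "x \<in> N z" if x: "x \<in> {x1, x2}" for x
    proof -
      \<comment> \<open>An arc from \<open>b\<close> to \<open>x\<close> besides the one to
        \<open>x3\<close> would put \<open>N b\<close> inside \<open>X\<close>. Hence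
        \<open>a1\<close> is the only in-neighbour of \<open>x\<close> in \<open>S\<close>, and
        \<open>a\<close> must reach \<open>x\<close> in two steps; the middle vertex is not
        \<open>x3\<close>, so it is \<open>z\<close>.\<close>
      have only: "x \<notin> N b" if "b \<in> S" "b \<noteq> a1" for b
      proof
        assume "x \<in> N b"
        moreover have "x3 \<in> N b" using S_preds_of_missed[OF a1, of x3 b] that X x3 N1 by auto
        moreover have "x \<noteq> x3" "x \<in> X" using x X x3 by auto
        moreover have "card (N b) = 2" using card_N that S_V by auto
        ultimately have "N b \<subseteq> X" using card_2_obtain_other[of "N b" x3] X
          by (metis insertE insert_subset empty_subsetI insertCI singletonD)
        then show False using two_full_False[OF a1, of b] that by auto
      qed
      have "x \<in> X" using x X by auto
      then show ?thesis
      proof (rule in_neighbours_X)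
        fix c d assume "c \<in> S" "d \<in> S" "c \<noteq> d" "x \<in> N c" "x \<in> N d"
        then show ?thesis using only by metis
      next
        fix c assume c: "c \<in> S" "x \<in> N c" "\<And>b. b \<in> S - {c} \<Longrightarrow> x \<notin> N b \<and> W 2 b x = 1"
          "\<And>y. y \<in> X \<Longrightarrow> x \<notin> N y"
        then have "c = a1" using only by auto
        then have "W 2 a x = 1" using c(3) aS by auto
        then obtain y where "y \<in> N a" "x \<in> N y" using walks_2_middle aS(3) by metis
        then show ?thesis using z c(4)[of x3] X by auto
      qed
    qed
    then have "N z = {x1, x2}"
      using card_N[OF zV] finite_N[OF zV] N1 by (intro card_subset_eq[symmetric]) auto
    then show ?thesis using z zX by auto
  qed
  obtain z2 z3 where "N a2 = {x3, z2}" "z2 \<notin> X" "N z2 = {x1, x2}" "N a3 = {x3, z3}" "z3 \<notin> X" "N z3 = {x1, x2}"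
    using N23 by metis
  then show False using no_three_arcs S(1) X(1) N1(1) by metis
qed

end

section \<open>Transfer from arcs to out-neighbourhoods\<close>

definition (in pre_digraph) out_neighbours :: "'a \<Rightarrow> 'a set" where
  "out_neighbours u = head G ` out_arcs G u"

context digraph
begin

lemma inj_on_head_out_arcs: "inj_on (head G) (out_arcs G u)"
  by (auto intro!: inj_onI no_multi_arcs simp: arc_to_ends_def)

lemma inj_on_tail_in_arcs: "inj_on (tail G) (in_arcs G v)"
  by (auto intro!: inj_onI no_multi_arcs simp: arc_to_ends_def)

lemma card_out_neighbours: "card (out_neighbours u) = out_degree G u"
  by (simp add: out_neighbours_def out_degree_def card_image inj_on_head_out_arcs)

lemma card_in_neighbours: "card {u \<in> verts G. v \<in> out_neighbours u} = in_degree G v"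
proof -
  have "{u \<in> verts G. v \<in> out_neighbours u} = tail G ` in_arcs G v"
    by (auto simp: out_neighbours_def)
  then show ?thesis by (simp add: in_degree_def card_image inj_on_tail_in_arcs)
qed

text \<open>Walks are split by their first arc. Finiteness is carried through the same induction
  because the cardinality of the disjoint union requires finite pieces.\<close>

lemma walks_eq_card_awalk:
  "finite {p. awalk u p v \<and> length p = j}"
  "u \<in> verts G \<Longrightarrow> walks out_neighbours j u v = card {p. awalk u p v \<and> length p = j}"
proof (induction j arbitrary: u)
  case 0
  {
    case 1
    have "{p. awalk u p v \<and> length p = 0} \<subseteq> {[]}" by auto
    then show ?case by (rule finite_subset) simp
  next
    case 2
    have "{p. awalk u p v \<and> length p = 0} = (if u = v then {[]} else {})"
      using 2 by (auto simp: awalk_Nil_iff)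
    then show ?case by simp
  }
next
  case (Suc j)
  let ?A = "\<lambda>e. {p. awalk (head G e) p v \<and> length p = j}"
  have eq: "{p. awalk u p v \<and> length p = Suc j} = (\<Union>e\<in>out_arcs G u. (#) e ` ?A e)" for u
    by (auto simp: length_Suc_conv awalk_Cons_iff image_iff)
  have fin: "finite ((#) e ` ?A e)" for e using Suc.IH(1) by simp
  {
    case 1
    show ?case unfolding eq using fin by blast
  next
    case 2
    have "card {p. awalk u p v \<and> length p = Suc j} = (\<Sum>e\<in>out_arcs G u. card ((#) e ` ?A e))"
      unfolding eq using fin by (intro card_UN_disjoint) auto
    also have "\<dots> = (\<Sum>e\<in>out_arcs G u. walks out_neighbours j (head G e) v)"
      by (intro sum.cong) (auto simp: card_image Suc.IH(2))
    also have "\<dots> = walks out_neighbours (Suc j) u v"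
      by (simp add: out_neighbours_def sum.reindex[OF inj_on_head_out_arcs])
    finally show ?case by simp
  }
qed

lemma k_geodetic_walks_upto:
  assumes "k_geodetic k G" "u \<in> verts G" "v \<in> verts G"
  shows "walks_upto out_neighbours k u v \<le> 1"
proof -
  let ?P = "{p. awalk u p v \<and> length p \<le> k}"
  have "walks_upto out_neighbours k u v = (\<Sum>j\<le>k. card {p. awalk u p v \<and> length p = j})"
    unfolding walks_upto_def using walks_eq_card_awalk(2)[OF assms(2)] by simp
  also have "\<dots> = card (\<Union>j\<le>k. {p. awalk u p v \<and> length p = j})"
    using walks_eq_card_awalk(1) by (intro card_UN_disjoint[symmetric]) auto
  also have "(\<Union>j\<le>k. {p. awalk u p v \<and> length p = j}) = ?P" by auto
  finally have "walks_upto out_neighbours k u v = card ?P" .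
  moreover have fin: "finite ?P"
    by (rule finite_subset[of _ "\<Union>j\<le>k. {p. awalk u p v \<and> length p = j}"])
      (use walks_eq_card_awalk(1) in auto)
  moreover have "\<forall>p\<in>?P. \<forall>q\<in>?P. p = q"
    using assms unfolding k_geodetic_def Uniq_def by blast
  then have "card ?P \<le> Suc 0" unfolding card_le_Suc0_iff_eq[OF fin] .
  ultimately show ?thesis by simp
qed

lemma sum_out_degree: "(\<Sum>v\<in>verts G. out_degree G v) = card (arcs G)"
proof -
  have "(\<Sum>v\<in>verts G. out_degree G v) = card (\<Union>v\<in>verts G. out_arcs G v)"
    unfolding out_degree_def by (intro card_UN_disjoint[symmetric]) auto
  also have "(\<Union>v\<in>verts G. out_arcs G v) = arcs G" by auto
  finally show ?thesis .
qed

lemma sum_in_degree: "(\<Sum>v\<in>verts G. in_degree G v) = card (arcs G)"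
proof -
  have "(\<Sum>v\<in>verts G. in_degree G v) = card (\<Union>v\<in>verts G. in_arcs G v)"
    unfolding in_degree_def by (intro card_UN_disjoint[symmetric]) auto
  also have "(\<Union>v\<in>verts G. in_arcs G v) = arcs G" by auto
  finally show ?thesis .
qed

end

theorem theorem8:
  fixes k :: nat
  assumes "k \<ge> 3"
  shows "\<not> (\<exists>G :: ('a, 'b) pre_digraph.
            digraph G \<and>
            k_geodetic k G \<and>
            min_out_degree G \<ge> 2 \<and>
            card (verts G) = moore_bound 2 k + 2 \<and>
            in_degree_sequence G =
              replicate 3 1 @ replicate (card (verts G) - 6) 2 @ replicate 3 3)"
proof
  assume "\<exists>G :: ('a, 'b) pre_digraph.
            digraph G \<and>
            k_geodetic k G \<and>
            min_out_degree G \<ge> 2 \<and>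
            card (verts G) = moore_bound 2 k + 2 \<and>
            in_degree_sequence G =
              replicate 3 1 @ replicate (card (verts G) - 6) 2 @ replicate 3 3"
  then obtain G :: "('a, 'b) pre_digraph" where G: "digraph G" "k_geodetic k G"
    "min_out_degree G \<ge> 2" "card (verts G) = moore_bound 2 k + 2"
    "in_degree_sequence G = replicate 3 1 @ replicate (card (verts G) - 6) 2 @ replicate 3 3"
    by blast
  interpret digraph G by (rule G(1))
  define S where "S = {v \<in> verts G. in_degree G v = 1}"
  define X where "X = {v \<in> verts G. in_degree G v = 3}"
  have seq: "card S = 3" "card X = 3" "\<forall>v\<in>verts G. in_degree G v \<in> {1, 2, 3}"
    using G(5) in_degree_sequence_iff[OF finite_verts] unfolding S_def X_def by auto
  have indeg: "in_degree G v + of_bool (v \<in> S) = 2 + of_bool (v \<in> X)" if "v \<in> verts G" for v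
    using seq(3) that by (auto simp: S_def X_def)
  have "(\<Sum>v\<in>verts G. in_degree G v + of_bool (v \<in> S)) = (\<Sum>v\<in>verts G. 2 + of_bool (v \<in> X))"
    by (intro sum.cong indeg refl)
  then have "(\<Sum>v\<in>verts G. in_degree G v) + (\<Sum>v\<in>verts G. of_bool (v \<in> S))
      = (\<Sum>v\<in>verts G. 2) + (\<Sum>v\<in>verts G. of_bool (v \<in> X))"
    by (simp only: sum.distrib)
  moreover have "verts G \<inter> S = S" "verts G \<inter> X = X" by (auto simp: S_def X_def)
  \<comment> \<open>The three deficits on \<open>S\<close> balance the three surpluses on
    \<open>X\<close>.\<close>
  ultimately have sum_in: "(\<Sum>v\<in>verts G. in_degree G v) = 2 * card (verts G)"
    using seq(1,2) by (simp add: sum.distrib)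
  have out_ge: "out_degree G v \<ge> 2" if "v \<in> verts G" for v
    using G(3) that unfolding min_out_degree_def
    by (meson Min_le finite_imageI finite_verts imageI order_trans)
  \<comment> \<open>Out-degrees have the same sum \<open>2 * card (verts G)\<close> as in-degrees,
    so none can exceed the minimum 2.\<close>
  have out: "out_degree G v = 2" if v: "v \<in> verts G" for v
  proof (rule ccontr)
    assume "out_degree G v \<noteq> 2"
    then have "2 < out_degree G v" using out_ge[OF v] by simp
    then have "(\<Sum>v\<in>verts G. 2) < (\<Sum>v\<in>verts G. out_degree G v)"
      using v out_ge by (intro sum_strict_mono_ex1) auto
    then show False using sum_in sum_in_degree sum_out_degree by simp
  qed
  have "moore_bound 2 k = 2 ^ Suc k - 1"
    unfolding moore_bound_def by (induction k) (auto simp: atLeast0AtMost)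
  moreover have "(2::nat) ^ Suc k \<ge> 1" by simp
  ultimately have card_V: "card (verts G) = 2 ^ Suc k + 1" using G(4) by simp
  interpret excess_two "verts G" out_neighbours k
  proof
    show "out_neighbours u \<subseteq> verts G" for u by (auto simp: out_neighbours_def)
    show "walks_upto out_neighbours k u v \<le> 1" if "u \<in> verts G" "v \<in> verts G" for u v
      using k_geodetic_walks_upto[OF G(2) that] .
  qed (use out assms card_V in \<open>auto simp: card_out_neighbours\<close>)
  interpret excess_two_near_regular "verts G" out_neighbours k S X
    by unfold_locales
      (use seq(1,2) indeg in \<open>auto simp: S_def X_def preds_def card_in_neighbours\<close>)
  show False by (rule no_near_regular_excess_two)
qed

end
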